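(* Let $T>0$, $m^{\rm lab}>0$, and let $x:[0,T)\to\mathbb{R}^n$, $t\mapsto x_t$, be the sampling path of a ForM (Force Matching) model, that is, a solution of the ForM sampling ODE $$\ddot{x}_t=\frac{1}{m^{\rm lab}\gamma_t}\left(f_t^{\rm local}-\frac{\langle v_t^{\rm lab},f_t^{\rm local}\rangle}{c^2}\,v_t^{\rm lab}\right),\qquad x_0\sim\mathcal{N}(0,I),\quad \dot{x}_0=0,$$ where $v_t^{\rm lab}=\dot{x}_t$ and $f_t^{\rm local}=f_t(x_t)$. Then $$\|\dot{x}_t\|_2<c\qquad\text{for all } t\in[0,T).$$
   Context: Dots denote derivatives with respect to (lab) time $t$: $\dot{x}_t=\frac{\mathrm{d}x_t}{\mathrm{d}t}$ and $\ddot{x}_t=\frac{\mathrm{d}^2x_t}{\mathrm{d}t^2}$. $\langle\cdot,\cdot\rangle$ is the Euclidean inner product on $\mathbb{R}^n$ and $\|\cdot\|_2$ is the Euclidean norm. $c=3\times10^8$ is a constant (the speed of light), and $m^{\rm lab}$ is a constant (the mass). $f_t:\mathbb{R}^n\to\mathbb{R}^n$ is a given time-dependent force field, and $f_t^{\rm local}=f_t(x_t)$ is the relativistic force at position $x_t$. The Lorentz factor at time $t$ is $$\gamma_t:=\frac{1}{\sqrt{1-\|v_t^{\rm lab}\|_2^2/c^2}}.$$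
   Formalization: Added assumption: the force f_t(x_t) along the path is (Henstock–Kurzweil) integrable on [0,b] for every b<T, as it is for continuous f; without it a force blowing up in finite time can bring the speed to c. At speed c the right-hand side of the ODE is read as 0. *)

theory Defs
  imports "HOL-Probability.Probability"
begin

definition c_light :: real where
  "c_light = 3 * 10 ^ 8"

definition lorentz_factor :: "'a::real_normed_vector \<Rightarrow> real" where
  "lorentz_factor v = 1 / sqrt (1 - (norm v)\<^sup>2 / c_light\<^sup>2)"

definition std_gaussian_density :: "real ^ 'n \<Rightarrow> real" where
  "std_gaussian_density z = exp (- (norm z)\<^sup>2 / 2) / (2 * pi) powr (real CARD('n) / 2)"

text \<open>Derivatives are taken within \<open>{0..<T}\<close>, hence one-sided at time 0.\<close>

definition lab_velocity :: "real \<Rightarrow> (real \<Rightarrow> 'a::real_normed_vector) \<Rightarrow> real \<Rightarrow> 'a" where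
  "lab_velocity T x t = vector_derivative x (at t within {0..<T})"

definition ForM_acceleration :: "real \<Rightarrow> 'a::real_inner \<Rightarrow> 'a \<Rightarrow> 'a" where
  "ForM_acceleration m v F =
     (1 / (m * lorentz_factor v)) *\<^sub>R (F - ((v \<bullet> F) / c_light\<^sup>2) *\<^sub>R v)"

text \<open>No bound on the speed is built in. Where the speed equals the speed of light the Lorentz
  factor takes the value 0 (division by zero), so that the equation demands zero acceleration,
  which is the limit of its right-hand side for a fixed force.\<close>

definition ForM_solution ::
    "real \<Rightarrow> real \<Rightarrow> (real \<Rightarrow> 'a \<Rightarrow> 'a) \<Rightarrow> (real \<Rightarrow> 'a::real_inner) \<Rightarrow> bool" where
  "ForM_solution m T f x \<longleftrightarrow>
     (\<forall>t\<in>{0..<T}.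
        x differentiable (at t within {0..<T}) \<and>
        (lab_velocity T x has_vector_derivative
           ForM_acceleration m (lab_velocity T x t) (f t (x t))) (at t within {0..<T})) \<and>
     lab_velocity T x 0 = 0"

text \<open>The force experienced along the path has a finite impulse over every compact time interval.
  Without a condition of this kind a force that blows up in finite time can accelerate the particle
  to the speed of light. A jointly continuous force field always satisfies it, see below.\<close>

definition finite_impulse ::
    "real \<Rightarrow> (real \<Rightarrow> 'a \<Rightarrow> 'a) \<Rightarrow> (real \<Rightarrow> 'a::euclidean_space) \<Rightarrow> bool" where
  "finite_impulse T f x \<longleftrightarrow> (\<forall>b\<in>{0..<T}. (\<lambda>t. f t (x t)) integrable_on {0..b})"

lemma finite_impulse_if_continuous:
  fixes x :: "real \<Rightarrow> 'a::euclidean_space"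
  assumes f: "continuous_on ({0..<T} \<times> UNIV) (\<lambda>(t, y). f t y)"
    and x: "ForM_solution m T f x"
  shows "finite_impulse T f x"
  unfolding finite_impulse_def
proof
  fix b assume "b \<in> {0..<T}"
  then have sub: "{0..b} \<subseteq> {0..<T}" by auto
  have "continuous_on {0..<T} x"
    using x by (auto simp: ForM_solution_def continuous_on_eq_continuous_within
        intro: differentiable_imp_continuous_within)
  then have "continuous_on {0..b} (\<lambda>t. (t, x t))"
    using sub by (intro continuous_intros) (auto intro: continuous_on_subset)
  then have "continuous_on {0..b} (\<lambda>t. (\<lambda>(t, y). f t y) (t, x t))"
    using sub by (intro continuous_on_compose2[OF f]) auto
  then show "(\<lambda>t. f t (x t)) integrable_on {0..b}"
    by (auto intro: integrable_continuous_real)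
qed

end

theory Submission imports Defs begin

text \<open>The relativistic momentum \<open>p = m \<gamma> v\<close> satisfies \<open>p' = F\<close> as long as the speed is below \<open>c\<close>.
  Let \<open>s\<close> be the first time at which the speed reaches \<open>c\<close>. On \<open>[0, s)\<close> the momentum is the impulse
  of the force, hence bounded by some \<open>B\<close>; that is \<open>m\<^sup>2 \<parallel>v\<parallel>\<^sup>2 \<le> B\<^sup>2 (1 - \<parallel>v\<parallel>\<^sup>2 / c\<^sup>2)\<close>. By continuity
  this persists at \<open>s\<close>, where the right-hand side is not positive, so that \<open>v = 0\<close> there: a
  contradiction.\<close>

definition momentum :: "real \<Rightarrow> 'a::real_normed_vector \<Rightarrow> 'a" where
  "momentum m v = (m * lorentz_factor v) *\<^sub>R v"

lemma c_light_pos: "c_light > 0"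
  by (simp add: c_light_def)

lemma slack_pos:
  assumes "norm v < c_light"
  shows "0 < 1 - (norm v)\<^sup>2 / c_light\<^sup>2"
  using assms c_light_pos by (simp add: power_strict_mono)

text \<open>Multiply the bound by the square root of the slack and square. The result is free of
  division, so both sides are continuous in \<open>v\<close> even at the speed of light.\<close>

lemma momentum_bound_imp_slack_bound:
  assumes v: "norm v < c_light" and "m > 0" and B: "norm (momentum m v) \<le> B"
  shows "m\<^sup>2 * (norm v)\<^sup>2 \<le> B\<^sup>2 * (1 - (norm v)\<^sup>2 / c_light\<^sup>2)"
proof -
  define q where "q = 1 - (norm v)\<^sup>2 / c_light\<^sup>2"
  have q: "q > 0"
    using slack_pos[OF v] by (simp add: q_def)
  have "m * norm v / sqrt q \<le> B"
    using B \<open>m > 0\<close> q by (simp add: momentum_def lorentz_factor_def q_def[symmetric] abs_mult)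
  then have "m * norm v \<le> B * sqrt q"
    using q by (simp add: field_simps)
  then have "(m * norm v)\<^sup>2 \<le> (B * sqrt q)\<^sup>2"
    using \<open>m > 0\<close> by (intro power_mono) auto
  then show ?thesis
    using q by (simp add: power_mult_distrib q_def[symmetric])
qed

text \<open>By the product rule there are two terms: mass times Lorentz factor times acceleration is
  the force minus a multiple of \<open>v t\<close>, and the derivative of the Lorentz factor
  restores exactly that multiple.\<close>

lemma has_vector_derivative_momentum:
  fixes v :: "real \<Rightarrow> 'a::real_inner"
  assumes v': "(v has_vector_derivative ForM_acceleration m (v t) F) (at t within S)"
    and slow: "norm (v t) < c_light" and "m > 0"
  shows "((\<lambda>t. momentum m (v t)) has_vector_derivative F) (at t within S)"
proof -
  define a where "a = ForM_acceleration m (v t) F"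
  define q where "q t = 1 - (v t \<bullet> v t) / c_light\<^sup>2" for t
  define r where "r = sqrt (q t)"
  have q: "q t > 0"
    using slack_pos[OF slow] by (simp add: q_def power2_norm_eq_inner)
  then have r: "r > 0" and r2: "r\<^sup>2 = q t"
    by (auto simp: r_def)
  have \<gamma>: "lorentz_factor (v t) = 1 / sqrt (q t)" for t
    by (simp add: lorentz_factor_def q_def power2_norm_eq_inner)
  have a: "a = (r / m) *\<^sub>R (F - ((v t \<bullet> F) / c_light\<^sup>2) *\<^sub>R v t)"
    by (simp add: a_def ForM_acceleration_def \<gamma> r_def)
  \<comment> \<open>Pairing the bracket in \<open>a\<close> with \<open>v t\<close> produces the
    slack \<open>q t\<close>, that is \<open>r ^ 2\<close>. The resulting \<open>r ^ 3\<close>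
    cancels the one from differentiating \<open>1 / sqrt (q t)\<close>.\<close>
  have "v t \<bullet> a = (r / m) * ((v t \<bullet> F) * q t)"
    by (simp add: a q_def inner_diff_right algebra_simps)
  then have va: "v t \<bullet> a = r ^ 3 * (v t \<bullet> F) / m"
    by (simp add: r2[symmetric] power2_eq_square power3_eq_cube)
  have "((\<lambda>t. v t \<bullet> v t) has_vector_derivative (v t \<bullet> a + a \<bullet> v t)) (at t within S)"
    using bounded_bilinear.has_vector_derivative[OF bounded_bilinear_inner v' v']
    by (simp add: a_def)
  then have vv: "((\<lambda>t. v t \<bullet> v t) has_real_derivative 2 * (v t \<bullet> a)) (at t within S)"
    by (simp add: has_real_derivative_iff_has_vector_derivative inner_commute)
  have "(q has_real_derivative - (2 * (v t \<bullet> a)) / c_light\<^sup>2) (at t within S)"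
    using DERIV_diff[OF DERIV_const DERIV_cdivide[OF vv]] by (simp add: q_def[abs_def])
  then have g': "((\<lambda>t. m * (1 / sqrt (q t))) has_real_derivative
      m * ((v t \<bullet> a) / (c_light\<^sup>2 * r ^ 3))) (at t within S)"
    using q r r2[symmetric] c_light_pos
    by (auto intro!: derivative_eq_intros simp: r_def[symmetric] field_simps power2_eq_square
        power3_eq_cube)
  have "((\<lambda>t. (m * (1 / sqrt (q t))) *\<^sub>R v t) has_vector_derivative
      (m * (1 / sqrt (q t))) *\<^sub>R a + (m * ((v t \<bullet> a) / (c_light\<^sup>2 * r ^ 3))) *\<^sub>R v t) (at t within S)"
    by (rule has_vector_derivative_scaleR[OF g' v'[folded a_def]])
  also have "(m * (1 / sqrt (q t))) *\<^sub>R a = F - ((v t \<bullet> F) / c_light\<^sup>2) *\<^sub>R v t"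
    using r \<open>m > 0\<close> by (simp add: a r_def[symmetric])
  also have "m * ((v t \<bullet> a) / (c_light\<^sup>2 * r ^ 3)) = (v t \<bullet> F) / c_light\<^sup>2"
    using r \<open>m > 0\<close> by (simp add: va)
  finally show ?thesis
    by (simp add: momentum_def \<gamma>)
qed

text \<open>The momentum starts at 0 and is an antiderivative of \<open>F\<close>. For the gauge
  integral this suffices, with no continuity of \<open>F\<close>.\<close>

lemma integral_force_eq_momentum:
  fixes v F :: "real \<Rightarrow> 'a::euclidean_space"
  assumes "m > 0" "0 \<le> u" "v 0 = 0"
    and "\<And>t. t \<in> {0..u} \<Longrightarrow>
      (v has_vector_derivative ForM_acceleration m (v t) (F t)) (at t within {0..u})"
    and "\<And>t. t \<in> {0..u} \<Longrightarrow> norm (v t) < c_light"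
  shows "integral {0..u} F = momentum m (v u)"
proof -
  have "(F has_integral momentum m (v u) - momentum m (v 0)) {0..u}"
    using assms by (intro fundamental_theorem_of_calculus has_vector_derivative_momentum) auto
  then show ?thesis
    using \<open>v 0 = 0\<close> by (auto simp: momentum_def)
qed

lemma speed_less_c_light:
  fixes v F :: "real \<Rightarrow> 'a::euclidean_space"
  assumes "m > 0" "0 \<le> b" "v 0 = 0"
    and v': "\<And>t. t \<in> {0..b} \<Longrightarrow>
      (v has_vector_derivative ForM_acceleration m (v t) (F t)) (at t within {0..b})"
    and F: "F integrable_on {0..b}"
  shows "norm (v b) < c_light"
proof (rule ccontr)
  assume "\<not> norm (v b) < c_light"
  have cont: "continuous_on {0..b} v"
    using v' by (rule continuous_on_vector_derivative)
  define K where "K = {t \<in> {0..b}. c_light \<le> norm (v t)}"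
  have "closed K"
    unfolding K_def using cont by (intro continuous_on_closed_Collect_le continuous_intros) auto
  moreover have "bounded K"
    by (rule bounded_subset[of "{0..b}"]) (auto simp: K_def)
  ultimately have "compact K"
    by (simp add: compact_eq_bounded_closed)
  moreover have "b \<in> K"
    using \<open>\<not> norm (v b) < c_light\<close> \<open>0 \<le> b\<close> by (simp add: K_def)
  ultimately obtain s where "s \<in> K" and first: "\<And>t. t \<in> K \<Longrightarrow> s \<le> t"
    using compact_attains_inf[of K] by auto
  then have s: "0 \<le> s" "s \<le> b" "c_light \<le> norm (v s)"
    by (auto simp: K_def)
  have slow: "norm (v t) < c_light" if "0 \<le> t" "t < s" for t
    using first[of t] that s by (force simp: K_def)
  have "0 < s"
    using s \<open>v 0 = 0\<close> c_light_pos by (cases "s = 0") auto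
  \<comment> \<open>The impulse depends continuously on its upper limit, so a single bound serves
    all times up to \<open>b\<close>, in particular those approaching \<open>s\<close>.\<close>
  have "bounded ((\<lambda>u. integral {0..u} F) ` {0..b})"
    using indefinite_integral_continuous_1[OF F]
    by (intro compact_imp_bounded compact_continuous_image) auto
  then obtain B where B: "\<And>u. u \<in> {0..b} \<Longrightarrow> norm (integral {0..u} F) \<le> B"
    unfolding bounded_iff by blast
  \<comment> \<open>The momentum itself cannot be carried to the limit: at speed
    \<open>c_light\<close> division by zero makes it 0. The function \<open>h\<close> encodes its
    bound before \<open>s\<close> and stays continuous at \<open>s\<close>.\<close>
  define h where "h t = m\<^sup>2 * (norm (v t))\<^sup>2 - B\<^sup>2 * (1 - (norm (v t))\<^sup>2 / c_light\<^sup>2)" for t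
  have "h s \<le> 0"
  proof (rule continuous_le_on_closure[where f = h])
    show "continuous_on (closure {0..<s}) h"
      unfolding h_def using \<open>0 < s\<close> s
      by (auto intro!: continuous_intros continuous_on_subset[OF cont] simp: c_light_def)
    show "s \<in> closure {0..<s}"
      using \<open>0 < s\<close> by simp
    fix u assume "u \<in> {0..<s}"
    then have u: "0 \<le> u" "u < s" by auto
    \<comment> \<open>As \<open>u < s\<close>, the speed is below \<open>c_light\<close> on the
      whole closed interval \<open>{0..u}\<close>.\<close>
    have "integral {0..u} F = momentum m (v u)"
      using \<open>m > 0\<close> \<open>v 0 = 0\<close> u s slow
      by (intro integral_force_eq_momentum has_vector_derivative_within_subset[OF v']) auto
    with B[of u] have "norm (momentum m (v u)) \<le> B"
      using u s by simp
    then show "h u \<le> 0"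
      using momentum_bound_imp_slack_bound[OF slow \<open>m > 0\<close>] u by (simp add: h_def)
  qed
  moreover have "B\<^sup>2 * (1 - (norm (v s))\<^sup>2 / c_light\<^sup>2) \<le> 0"
    using s(3) c_light_pos by (intro mult_nonneg_nonpos) (auto simp: power_mono)
  moreover have "0 < m\<^sup>2 * (norm (v s))\<^sup>2"
    using s(3) c_light_pos \<open>m > 0\<close> by (intro mult_pos_pos zero_less_power) linarith+
  ultimately show False
    by (simp add: h_def)
qed

theorem theoremA3:
  fixes T m_lab :: real
    and f :: "real \<Rightarrow> real ^ 'n \<Rightarrow> real ^ 'n"
    and M :: "'w measure"
    and x :: "'w \<Rightarrow> real \<Rightarrow> real ^ 'n"
    and \<omega> :: 'w
  assumes "T > 0" and "m_lab > 0"
    and "prob_space M"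
    and "distributed M lborel (\<lambda>w. x w 0) std_gaussian_density"
    and "\<omega> \<in> space M"
    and "ForM_solution m_lab T f (x \<omega>)"
    and "finite_impulse T f (x \<omega>)"
  shows "\<forall>t\<in>{0..<T}. norm (lab_velocity T (x \<omega>) t) < c_light"
proof
  fix b assume b: "b \<in> {0..<T}"
  show "norm (lab_velocity T (x \<omega>) b) < c_light"
  \<comment> \<open>Each time \<open>b\<close> is treated on the compact interval
    \<open>{0..b}\<close>, where the impulse is finite; derivatives within \<open>{0..<T}\<close>
    restrict to it.\<close>
  proof (rule speed_less_c_light)
    show "lab_velocity T (x \<omega>) 0 = 0"
      using assms(6) by (simp add: ForM_solution_def)
    show "(\<lambda>t. f t (x \<omega> t)) integrable_on {0..b}"
      using assms(7) b by (simp add: finite_impulse_def)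
    show "(lab_velocity T (x \<omega>) has_vector_derivative
        ForM_acceleration m_lab (lab_velocity T (x \<omega>) t) (f t (x \<omega> t))) (at t within {0..b})"
      if "t \<in> {0..b}" for t
      by (rule has_vector_derivative_within_subset[of _ _ _ "{0..<T}"])
        (use assms(6) b that in \<open>auto simp: ForM_solution_def\<close>)
  qed (use assms(2) b in auto)
qed

end
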